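(* Let $\mathcal{C}\subseteq\mathbb{F}_2^N$ be a linear block code of dimension $K$ and consider an ORB-type GRAND algorithm with ordered list of distinct error patterns $\underline{e}(1),\dots,\underline{e}(T)$ and permutation law $\pi=\pi_{\underline{Y}}$, with the transmitted codeword $\underline{W}$ uniform on $\mathcal{C}$ and each coordinate $W_i$ uniform on $\mathbb{F}_2$. Then the block error rate is $$P_{\mathrm{err}}=1-P_{\mathrm{succ}}=1-\sum_{t=1}^{T}p_t\,\Pr\!\left(\pi(\underline{e}(t')\oplus\underline{e}(t))\notin\mathcal{C},\ \forall\,t'<t\ \middle|\ \theta(\underline{Y})\oplus\pi(\underline{e}(t))=\underline{W}\right),$$ where $p_t=\mathbf{E}_{\underline{Y}}\left[P_{\underline{W}|\underline{Y}}(\theta(\underline{Y})\oplus\pi(\underline{e}(t))\mid\underline{Y})\right]$ (terms with $p_t=0$ are read as $0$). If moreover the channel is output-symmetric, the reliabilities $|\ell_i|$ have a continuous (atomless) distribution, and $\pi$ is the rank-based permutation, then $$P_{\mathrm{err}}=1-\sum_{t=1}^{T}p_t\Pr\left(\pi(\underline{e}(t')\oplus\underline{e}(t))\notin\mathcal{C},\ \forall\,t'<t\right).$$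
   Context: Channel: $q_0,q_1$ are probability densities on $\mathbb{R}$; when $\underline{w}\in\mathbb{F}_2^N$ is sent, the output $\underline{Y}\in\mathbb{R}^N$ has density $\prod_i q_{w_i}(y_i)$. The log-likelihood ratios are $\ell_i=\log(q_0(y_i)/q_1(y_i))$ and the hard decision is $\theta(\underline{y})\in\mathbb{F}_2^N$ with $\theta(\underline y)_i=\mathbf{1}(\ell_i<0)$. The channel is output-symmetric if $q_0(y)=q_1(-y)$ for all $y\in\mathbb{R}$. ORB-type GRAND: an ordered list of $T$ distinct vectors $\underline{e}(1),\dots,\underline{e}(T)\in\mathbb{F}_2^N$ (error patterns) is fixed in advance, independent of $\underline{Y}$; a permutation law assigns (measurably) to each $\underline{y}\in\mathbb{R}^N$ a permutation $\pi_{\underline{y}}$ of the coordinates $\{1,\dots,N\}$, acting on vectors of $\mathbb{F}_2^N$ by permuting coordinates. Given $\underline{y}$, the decoder tests for $t=1,2,\dots,T$ whether $\theta(\underline{y})\oplus\pi_{\underline{y}}(\underline{e}(t))\in\mathcal{C}$; it stops at the first $t$ for which this holds and outputs that codeword; if no $t\le T$ works, it declares failure. $P_{\mathrm{err}}$ is the probability that the output is not the transmitted codeword (failure counts as an error). Rank-based permutation: let $r_i$ be the position of $|\ell_i|$ in the ascending ordering of $|\ell_1|,\dots,|\ell_N|$; then $\pi_{\underline{y}}(\underline{e})_i=e_{r_i}$. A linear block code here is a $K$-dimensional linear subspace $\mathcal{C}$ of $\mathbb{F}_2^N$ (with $2^K$ codewords). *)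

theory Defs
  imports "HOL-Probability.Probability" "HOL-Library.Z2"
begin

text \<open>
  Words are vectors \<open>bit ^ 'n\<close> over the two-element field, and outputs are vectors \<open>real ^ 'n\<close>.
  The finite linear order \<open>'n\<close> plays the role of the coordinate set \<open>{1..N}\<close>, with
  \<open>N = CARD('n)\<close>; the order is what makes ``the position in a sorted arrangement'' an element
  of \<open>'n\<close>.
\<close>

definition prob_density :: "(real \<Rightarrow> real) \<Rightarrow> bool" where
  "prob_density f \<longleftrightarrow>
     f \<in> borel_measurable borel \<and> (\<forall>x. 0 \<le> f x) \<and> (\<integral>\<^sup>+x. ennreal (f x) \<partial>lborel) = 1"

definition channel_density :: "(bit \<Rightarrow> real \<Rightarrow> real) \<Rightarrow> bit ^ 'n::finite \<Rightarrow> real ^ 'n \<Rightarrow> real" where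
  "channel_density q w y = (\<Prod>i\<in>UNIV. q (w $ i) (y $ i))"

text \<open>
  \<open>uniform_measure M {\<omega> \<in> space M. W \<omega> = w}\<close> is \<open>M\<close> conditioned on the event that \<open>w\<close> is sent.
\<close>

definition channel_output ::
  "'a measure \<Rightarrow> (bit \<Rightarrow> real \<Rightarrow> real) \<Rightarrow> (bit ^ 'n::finite) set \<Rightarrow> ('a \<Rightarrow> bit ^ 'n) \<Rightarrow> ('a \<Rightarrow> real ^ 'n) \<Rightarrow> bool"
  where
  "channel_output M q C W Y \<longleftrightarrow>
     (\<forall>w\<in>C. distributed (uniform_measure M {\<omega> \<in> space M. W \<omega> = w}) lborel Y
              (\<lambda>y. ennreal (channel_density q w y)))"

text \<open>
  Densities may vanish, so \<open>log (q\<^sub>0 / q\<^sub>1)\<close> is extended real. Where both densities vanish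
  it is undefined (set to \<open>0\<close> here); such outputs have probability zero.
\<close>

definition llr :: "(bit \<Rightarrow> real \<Rightarrow> real) \<Rightarrow> real \<Rightarrow> ereal" where
  "llr q y =
     (if q 0 y = 0 \<and> q 1 y = 0 then 0
      else if q 1 y = 0 then \<infinity>
      else if q 0 y = 0 then -\<infinity>
      else ereal (ln (q 0 y / q 1 y)))"

definition hard_decision :: "(bit \<Rightarrow> real \<Rightarrow> real) \<Rightarrow> real ^ 'n::finite \<Rightarrow> bit ^ 'n" where
  "hard_decision q y = (\<chi> i. if llr q (y $ i) < 0 then 1 else 0)"

definition output_symmetric :: "(bit \<Rightarrow> real \<Rightarrow> real) \<Rightarrow> bool" where
  "output_symmetric q \<longleftrightarrow> (\<forall>y. q 0 y = q 1 (- y))"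

definition permutation_law :: "(real ^ 'n::finite \<Rightarrow> 'n \<Rightarrow> 'n) \<Rightarrow> bool" where
  "permutation_law r \<longleftrightarrow> (\<forall>y. bij (r y)) \<and> r \<in> borel \<rightarrow>\<^sub>M count_space UNIV"

definition permute_coords :: "('n::finite \<Rightarrow> 'n) \<Rightarrow> bit ^ 'n \<Rightarrow> bit ^ 'n" where
  "permute_coords \<sigma> e = (\<chi> i. e $ \<sigma> i)"

text \<open>
  For a permutation \<open>r y\<close> of \<open>'n\<close> this says that \<open>r y i\<close> is the position of the reliability of
  coordinate \<open>i\<close> in an ascending arrangement of all reliabilities. If the reliabilities are
  distinct, \<open>r y\<close> is uniquely determined; ties may be broken in any way.
\<close>

definition rank_based ::
  "(bit \<Rightarrow> real \<Rightarrow> real) \<Rightarrow> (real ^ 'n::{finite,linorder} \<Rightarrow> 'n \<Rightarrow> 'n) \<Rightarrow> bool" where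
  "rank_based q r \<longleftrightarrow>
     (\<forall>y i j. \<bar>llr q (y $ i)\<bar> < \<bar>llr q (y $ j)\<bar> \<longrightarrow> r y i < r y j)"

definition atomless_reliabilities ::
  "'a measure \<Rightarrow> (bit \<Rightarrow> real \<Rightarrow> real) \<Rightarrow> ('a \<Rightarrow> real ^ 'n::finite) \<Rightarrow> bool" where
  "atomless_reliabilities M q Y \<longleftrightarrow>
     (\<forall>i (x::ereal). \<P>(\<omega> in M. \<bar>llr q (Y \<omega> $ i)\<bar> = x) = 0)"

text \<open>The word tested in step \<open>t\<close>; in characteristic two, \<open>+\<close> is the exclusive or.\<close>

definition candidate ::
  "(bit \<Rightarrow> real \<Rightarrow> real) \<Rightarrow> (real ^ 'n::finite \<Rightarrow> 'n \<Rightarrow> 'n) \<Rightarrow> (nat \<Rightarrow> bit ^ 'n) \<Rightarrow>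
   nat \<Rightarrow> real ^ 'n \<Rightarrow> bit ^ 'n" where
  "candidate q r e t y = hard_decision q y + permute_coords (r y) (e t)"

definition orb_grand ::
  "(bit \<Rightarrow> real \<Rightarrow> real) \<Rightarrow> (bit ^ 'n::finite) set \<Rightarrow> (real ^ 'n \<Rightarrow> 'n \<Rightarrow> 'n) \<Rightarrow>
   (nat \<Rightarrow> bit ^ 'n) \<Rightarrow> nat \<Rightarrow> real ^ 'n \<Rightarrow> (bit ^ 'n) option" where
  "orb_grand q C r e T y =
     (if \<exists>t\<in>{1..T}. candidate q r e t y \<in> C
      then Some (candidate q r e (LEAST t. t \<in> {1..T} \<and> candidate q r e t y \<in> C) y)
      else None)"

definition err_prob ::
  "'a measure \<Rightarrow> ('a \<Rightarrow> bit ^ 'n::finite) \<Rightarrow> ('a \<Rightarrow> real ^ 'n) \<Rightarrow>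
   (real ^ 'n \<Rightarrow> (bit ^ 'n) option) \<Rightarrow> real" where
  "err_prob M W Y decode = \<P>(\<omega> in M. decode (Y \<omega>) \<noteq> Some (W \<omega>))"

definition succ_prob ::
  "'a measure \<Rightarrow> ('a \<Rightarrow> bit ^ 'n::finite) \<Rightarrow> ('a \<Rightarrow> real ^ 'n) \<Rightarrow>
   (real ^ 'n \<Rightarrow> (bit ^ 'n) option) \<Rightarrow> real" where
  "succ_prob M W Y decode = \<P>(\<omega> in M. decode (Y \<omega>) = Some (W \<omega>))"

text \<open>
  The conditional probability of \<open>W = w\<close> given \<open>Y\<close>, as a random variable on \<open>M\<close> that is
  measurable with respect to the sigma-algebra generated by \<open>Y\<close>.
\<close>

definition posterior ::
  "'a measure \<Rightarrow> ('a \<Rightarrow> bit ^ 'n::finite) \<Rightarrow> ('a \<Rightarrow> real ^ 'n) \<Rightarrow> bit ^ 'n \<Rightarrow> 'a \<Rightarrow> real" where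
  "posterior M W Y w =
     real_cond_exp M (vimage_algebra (space M) Y borel) (indicator {\<omega> \<in> space M. W \<omega> = w})"

definition hit_prob ::
  "'a measure \<Rightarrow> (bit \<Rightarrow> real \<Rightarrow> real) \<Rightarrow> ('a \<Rightarrow> bit ^ 'n::finite) \<Rightarrow> ('a \<Rightarrow> real ^ 'n) \<Rightarrow>
   (real ^ 'n \<Rightarrow> 'n \<Rightarrow> 'n) \<Rightarrow> (nat \<Rightarrow> bit ^ 'n) \<Rightarrow> nat \<Rightarrow> real" where
  "hit_prob M q W Y r e t = (\<integral>\<omega>. posterior M W Y (candidate q r e t (Y \<omega>)) \<omega> \<partial>M)"

end

theory Submission
  imports Defs
begin

text \<open>
  In characteristic two, a candidate that hits the sent codeword turns the test of an earlier
  candidate into membership of the permuted difference of the two patterns, so success splits into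
  disjoint events indexed by the hitting step.

  For the rank-based permutation, fix the sent word \<open>w\<close>. Permuting the coordinates of the output by
  \<open>\<tau>\<close>, and flipping signs where \<open>w\<close> and its permuted version disagree, preserves the output law by
  output symmetry. Almost surely it composes the rank permutation with \<open>\<tau>\<close> and does not affect
  whether a candidate equals \<open>w\<close>. Hence, given \<open>w\<close>, the rank permutation is uniform and
  independent of that event, and since its law does not depend on \<open>w\<close>, the conditioning can be
  dropped.
\<close>

section \<open>Product measures on vectors and the channel law\<close>

text \<open>Boxes are closed under intersection and include the sets \<open>{..a}\<close>, so they
  generate the Borel sets. The whole space is itself a box of finite measure, which allows a
  constant exhausting sequence in the uniqueness theorem.\<close>

lemma measure_vec_eqI:
  fixes P Q :: "(real ^ 'n::finite) measure"
  assumes "sets P = sets borel" "sets Q = sets borel" "finite_measure P"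
    and box: "\<And>A. (\<And>i. A i \<in> sets borel) \<Longrightarrow>
      emeasure P {y. \<forall>i. y $ i \<in> A i} = emeasure Q {y. \<forall>i. y $ i \<in> A i}"
  shows "P = Q"
proof -
  let ?E = "{{y :: real ^ 'n. \<forall>i. y $ i \<in> A i} | A. \<forall>i. A i \<in> sets borel}"
  have "Int_stable ?E"
  proof (rule Int_stableI)
    fix a b assume "a \<in> ?E" "b \<in> ?E"
    then obtain A B where AB: "a = {y. \<forall>i. y $ i \<in> A i}" "b = {y. \<forall>i. y $ i \<in> B i}"
      and "\<forall>i. A i \<in> sets borel" "\<forall>i. B i \<in> sets borel" by blast
    then show "a \<inter> b \<in> ?E" by (auto intro!: exI[of _ "\<lambda>i. A i \<inter> B i"])
  qed
  moreover have "sigma_sets UNIV ?E = sets (borel :: (real ^ 'n) measure)"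
  proof
    have "{y. \<forall>i. y $ i \<in> A i} \<in> sets borel" if "\<forall>i. A i \<in> sets borel" for A :: "'n \<Rightarrow> real set"
      using that by measurable
    then show "sigma_sets UNIV ?E \<subseteq> sets (borel :: (real ^ 'n) measure)"
      by (auto intro!: sets.sigma_sets_subset[of _ borel, simplified])
    have "{..a} \<in> ?E" for a :: "real ^ 'n"
      by (auto simp: less_eq_vec_def intro!: exI[of _ "\<lambda>i. {..a $ i}"])
    then have "range atMost \<subseteq> ?E" by blast
    then have "sigma_sets UNIV (range atMost) \<subseteq> sigma_sets UNIV ?E"
      by (rule sigma_sets_mono')
    then show "sets (borel :: (real ^ 'n) measure) \<subseteq> sigma_sets UNIV ?E"
      by (subst borel_eq_atMost) simp
  qed
  moreover have "UNIV \<in> ?E" by (auto intro!: exI[of _ "\<lambda>i. UNIV"])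
  moreover have "emeasure P UNIV \<noteq> \<infinity>"
    using \<open>finite_measure P\<close> by (simp add: finite_measure.emeasure_finite)
  ultimately show ?thesis
    using assms(1,2) box
    by (intro measure_eqI_generator_eq[of ?E UNIV P Q "\<lambda>_. UNIV"]) auto
qed

text \<open>Tonelli for \<open>lborel\<close> as a product over \<open>Basis\<close>, transported to
  the index type along the injection \<open>\<lambda>i. axis i 1\<close>.\<close>

lemma nn_integral_lborel_vec_prod:
  assumes [measurable]: "\<And>i. g i \<in> borel_measurable borel"
  shows "(\<integral>\<^sup>+y. (\<Prod>i\<in>UNIV. g i (y $ i)) \<partial>(lborel :: (real ^ 'n::finite) measure)) =
    (\<Prod>i\<in>UNIV. \<integral>\<^sup>+x. g i x \<partial>lborel)"
proof -
  have Basis: "(Basis :: (real ^ 'n) set) = range (\<lambda>i. axis i 1)"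
    by (auto simp: Basis_vec_def)
  have inj: "inj (\<lambda>i::'n. axis i (1::real))" by (auto simp: inj_on_def axis_eq_axis)
  have "(\<integral>\<^sup>+y. (\<Prod>b\<in>Basis. g (axis_index b) (y \<bullet> b)) \<partial>(lborel :: (real ^ 'n) measure)) =
    (\<Prod>b\<in>(Basis :: (real ^ 'n) set). \<integral>\<^sup>+x. g (axis_index b) x \<partial>lborel)"
    by (rule nn_integral_lborel_prod) auto
  then show ?thesis
    unfolding Basis by (simp add: prod.reindex[OF inj] inner_axis)
qed

abbreviation channel_law :: "(bit \<Rightarrow> real \<Rightarrow> real) \<Rightarrow> bit ^ 'n::finite \<Rightarrow> (real ^ 'n) measure" where
  "channel_law q w \<equiv> density lborel (\<lambda>y. ennreal (channel_density q w y))"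

lemma channel_density_measurable:
  assumes "\<And>b. prob_density (q b)"
  shows "channel_density q w \<in> borel_measurable borel"
proof -
  have [measurable]: "q b \<in> borel_measurable borel" for b
    using assms by (simp add: prob_density_def)
  show ?thesis unfolding channel_density_def by measurable
qed

text \<open>Density and indicator of a box both factor over the coordinates. Together with
  uniqueness on boxes, this reduces all statements about the memoryless channel to one-dimensional
  integrals.\<close>

lemma emeasure_channel_law_box:
  assumes q: "\<And>b. prob_density (q b)" and A[measurable]: "\<And>i. A i \<in> sets borel"
  shows "emeasure (channel_law q w) {y. \<forall>i. y $ i \<in> A i} =
    (\<Prod>i\<in>UNIV. \<integral>\<^sup>+x. ennreal (q (w $ i) x) * indicator (A i) x \<partial>lborel)"
proof -
  have [measurable]: "q b \<in> borel_measurable borel" for b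
    using q by (simp add: prob_density_def)
  have nn: "0 \<le> q b x" for b x using q by (simp add: prob_density_def)
  note [measurable] = channel_density_measurable[OF q]
  have "emeasure (channel_law q w) {y. \<forall>i. y $ i \<in> A i} =
     (\<integral>\<^sup>+y. ennreal (channel_density q w y) * indicator {y. \<forall>i. y $ i \<in> A i} y \<partial>lborel)"
    by (rule emeasure_density) measurable
  also have "\<dots> = (\<integral>\<^sup>+y. (\<Prod>i\<in>UNIV. ennreal (q (w $ i) (y $ i)) * indicator (A i) (y $ i)) \<partial>lborel)"
  proof (intro nn_integral_cong)
    fix y
    have "(indicator {y. \<forall>i. y $ i \<in> A i} y :: ennreal) = (\<Prod>i\<in>UNIV. indicator (A i) (y $ i))"
      by (auto simp: indicator_def)
    then show "ennreal (channel_density q w y) * indicator {y. \<forall>i. y $ i \<in> A i} y =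
      (\<Prod>i\<in>UNIV. ennreal (q (w $ i) (y $ i)) * indicator (A i) (y $ i))"
      by (simp add: channel_density_def prod.distrib prod_ennreal nn)
  qed
  also have "\<dots> = (\<Prod>i\<in>UNIV. \<integral>\<^sup>+x. ennreal (q (w $ i) x) * indicator (A i) x \<partial>lborel)"
    by (rule nn_integral_lborel_vec_prod) measurable
  finally show ?thesis .
qed

lemma prob_space_channel_law:
  assumes q: "\<And>b. prob_density (q b)"
  shows "prob_space (channel_law q w)"
proof
  show "emeasure (channel_law q w) (space (channel_law q w)) = 1"
    using emeasure_channel_law_box[of q "\<lambda>_. UNIV" w] q by (simp add: prob_density_def)
qed

section \<open>Measurability of the decoder\<close>

lemma llr_measurable:
  assumes q: "\<And>b. prob_density (q b)"
  shows "llr q \<in> borel_measurable borel"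
proof -
  have [measurable]: "q b \<in> borel_measurable borel" for b
    using q by (simp add: prob_density_def)
  show ?thesis unfolding llr_def by measurable
qed

text \<open>Makes \<open>bit ^ 'n\<close> a finite type, so that words can be summed over and
  treated as discrete values.\<close>

instance bit :: finite
proof
  have "(UNIV :: bit set) = {0, 1}" by (auto intro: bit.exhaust)
  then show "finite (UNIV :: bit set)" by (metis finite.emptyI finite.insertI)
qed

text \<open>Preimages of singletons suffice in a finite discrete space, and each is a finite
  intersection of coordinate events.\<close>

lemma measurable_vec_finite:
  fixes f :: "'a \<Rightarrow> 'b::finite ^ 'n::finite"
  assumes "\<And>i. (\<lambda>x. f x $ i) \<in> N \<rightarrow>\<^sub>M count_space UNIV"
  shows "f \<in> N \<rightarrow>\<^sub>M count_space UNIV"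
proof (subst measurable_count_space_eq2)
  show "finite (UNIV :: ('b ^ 'n) set)" by simp
  have "{x \<in> space N. \<forall>i. f x $ i = v $ i} \<in> sets N" for v
    using assms by measurable
  moreover have "f -` {v} \<inter> space N = {x \<in> space N. \<forall>i. f x $ i = v $ i}" for v
    by (auto simp: vec_eq_iff)
  ultimately show "f \<in> space N \<rightarrow> UNIV \<and> (\<forall>v\<in>UNIV. f -` {v} \<inter> space N \<in> sets N)" by simp
qed

lemma candidate_measurable:
  assumes q: "\<And>b. prob_density (q b)" and r: "permutation_law r"
  shows "candidate q r e t \<in> borel \<rightarrow>\<^sub>M count_space UNIV"
proof -
  note [measurable] = llr_measurable[OF q]
  have [measurable]: "r \<in> borel \<rightarrow>\<^sub>M count_space UNIV" using r by (simp add: permutation_law_def)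
  have [measurable]: "hard_decision q \<in> borel \<rightarrow>\<^sub>M count_space UNIV"
    by (rule measurable_vec_finite) (simp add: hard_decision_def)
  show ?thesis unfolding candidate_def[abs_def]
    \<comment> \<open>The hard decision and the permutation take finitely many values; with both
      held fixed the candidate is constant.\<close>
    by (rule measurable_compose_countable[where g = "hard_decision q"],
        rule measurable_compose_countable[where g = r]) simp_all
qed

lemma orb_grand_measurable:
  assumes q: "\<And>b. prob_density (q b)" and r: "permutation_law r"
  shows "orb_grand q C r e T \<in> borel \<rightarrow>\<^sub>M count_space UNIV"
proof -
  note [measurable] = candidate_measurable[OF q r]
  have "orb_grand q C r e T =
     (\<lambda>y. if \<exists>t\<in>{1..T}. candidate q r e t y \<in> C
      then Some (candidate q r e (LEAST t. t \<in> {1..T} \<and> candidate q r e t y \<in> C) y)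
      else None)" by (rule ext) (simp only: orb_grand_def)
  moreover have "(\<lambda>y. Some (candidate q r e (LEAST t. t \<in> {1..T} \<and> candidate q r e t y \<in> C) y))
      \<in> borel \<rightarrow>\<^sub>M count_space UNIV"
    \<comment> \<open>The stopping index is a natural number, so measurability of the candidate at
      each fixed index is enough.\<close>
    by (rule measurable_compose_countable[where g = "\<lambda>y. LEAST t. t \<in> {1..T} \<and> candidate q r e t y \<in> C"])
      (rule measurable_compose[OF candidate_measurable[OF q r]], simp, measurable)
  ultimately show ?thesis by simp
qed

section \<open>Output symmetry and signed permutations\<close>

text \<open>Reflection exchanges the two densities and so inverts the likelihood ratio. The infinite
  values trade places and the default value 0 is its own negative.\<close>

lemma llr_minus:
  assumes "output_symmetric q" and q: "\<And>b. prob_density (q b)"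
  shows "llr q (- y) = - llr q y"
proof -
  have 0: "q 0 (- y) = q 1 y" and 1: "q 1 (- y) = q 0 y"
    using assms by (auto simp: output_symmetric_def)
  have "0 \<le> q b y" for b using q by (simp add: prob_density_def)
  then show ?thesis by (auto simp: llr_def 0 1 ln_div order_less_le)
qed

lemma output_symmetric_flip:
  assumes "output_symmetric q" "b \<noteq> c"
  shows "q b (- x) = q c x"
  using assms by (cases b; cases c) (auto simp: output_symmetric_def)

text \<open>The sign changes exactly where the sent bits at \<open>i\<close> and
  \<open>\<tau> i\<close> differ, so that under output symmetry the new coordinate \<open>i\<close>
  again has density \<open>q (w $ i)\<close>.\<close>

definition signed_permutation :: "bit ^ 'n \<Rightarrow> ('n::finite \<Rightarrow> 'n) \<Rightarrow> real ^ 'n \<Rightarrow> real ^ 'n" where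
  "signed_permutation w \<tau> y = (\<chi> i. if w $ i = w $ \<tau> i then y $ \<tau> i else - (y $ \<tau> i))"

lemma signed_permutation_measurable:
  "signed_permutation w \<tau> \<in> borel_measurable borel"
proof (rule borel_measurable_euclidean_space[THEN iffD2, rule_format])
  fix b :: "real ^ 'a" assume "b \<in> Basis"
  then obtain i where "b = axis i 1" by (auto simp: Basis_vec_def)
  then show "(\<lambda>y. signed_permutation w \<tau> y \<bullet> b) \<in> borel_measurable borel"
    by (simp add: signed_permutation_def inner_axis)
qed

text \<open>It is enough to compare boxes. The preimage of a box is a box with permuted and possibly
  reflected sides; reindexing the product by \<open>\<tau>\<close> matches the factors, and symmetry
  absorbs the reflections.\<close>

lemma distr_signed_permutation:
  assumes q: "\<And>b. prob_density (q b)" and sym: "output_symmetric q" and \<tau>: "bij \<tau>"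
  shows "distr (channel_law q w) borel (signed_permutation w \<tau>) = channel_law q w"
proof (rule measure_vec_eqI)
  note [measurable] = signed_permutation_measurable
  have [measurable]: "q b \<in> borel_measurable borel" for b
    using q by (simp add: prob_density_def)
  interpret prob_space "channel_law q w" by (rule prob_space_channel_law[OF q])
  show "finite_measure (distr (channel_law q w) borel (signed_permutation w \<tau>))"
    by (rule finite_measure_distr) simp
  fix A :: "'a \<Rightarrow> real set" assume A[measurable]: "\<And>i. A i \<in> sets borel"
  \<comment> \<open>The constraint that \<open>A\<close> imposes on the original coordinate
    \<open>j\<close>, which lands in position \<open>inv \<tau> j\<close>.\<close>
  define B where "B j = (if w $ inv \<tau> j = w $ j then A (inv \<tau> j) else uminus -` A (inv \<tau> j))" for j
  have [measurable]: "B j \<in> sets borel" for j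
  proof -
    have "uminus -` A (inv \<tau> j) \<inter> space borel \<in> sets borel" by measurable
    then show ?thesis by (simp add: B_def)
  qed
  have inv: "inv \<tau> (\<tau> i) = i" for i using \<tau> by (simp add: bij_is_inj)
  have "signed_permutation w \<tau> -` {y. \<forall>i. y $ i \<in> A i} = {y. \<forall>j. y $ j \<in> B j}"
  proof -
    have "(\<forall>j. y $ j \<in> B j) \<longleftrightarrow> (\<forall>i. y $ \<tau> i \<in> B (\<tau> i))" for y
      using \<tau> by (metis bij_pointE)
    then show ?thesis by (auto simp: signed_permutation_def B_def inv split: if_splits)
  qed
  then have "emeasure (distr (channel_law q w) borel (signed_permutation w \<tau>)) {y. \<forall>i. y $ i \<in> A i} =
    emeasure (channel_law q w) {y. \<forall>j. y $ j \<in> B j}"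
    by (subst emeasure_distr) simp_all
  also have "\<dots> = (\<Prod>j\<in>UNIV. \<integral>\<^sup>+x. ennreal (q (w $ j) x) * indicator (B j) x \<partial>lborel)"
    by (rule emeasure_channel_law_box) (use q in auto)
  also have "\<dots> = (\<Prod>i\<in>UNIV. \<integral>\<^sup>+x. ennreal (q (w $ \<tau> i) x) * indicator (B (\<tau> i)) x \<partial>lborel)"
    by (rule prod.reindex_bij_betw[OF \<tau>, symmetric])
  also have "\<dots> = (\<Prod>i\<in>UNIV. \<integral>\<^sup>+x. ennreal (q (w $ i) x) * indicator (A i) x \<partial>lborel)"
  proof (rule prod.cong[OF refl])
    fix i
    show "(\<integral>\<^sup>+x. ennreal (q (w $ \<tau> i) x) * indicator (B (\<tau> i)) x \<partial>lborel) =
      (\<integral>\<^sup>+x. ennreal (q (w $ i) x) * indicator (A i) x \<partial>lborel)"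
    proof (cases "w $ i = w $ \<tau> i")
      case True
      then show ?thesis by (simp add: B_def inv)
    next
      case False
      \<comment> \<open>The substitution of \<open>- x\<close> for \<open>x\<close> preserves
        Lebesgue measure; it undoes the reflection of the side and turns one density into the
        other.\<close>
      have "(\<integral>\<^sup>+x. ennreal (q (w $ \<tau> i) x) * indicator (B (\<tau> i)) x \<partial>lborel) =
        (\<integral>\<^sup>+x. ennreal (q (w $ \<tau> i) (- x)) * indicator (B (\<tau> i)) (- x) \<partial>lborel)"
        by (subst nn_integral_real_affine[where c = "-1" and t = 0]) auto
      also have "\<dots> = (\<integral>\<^sup>+x. ennreal (q (w $ i) x) * indicator (A i) x \<partial>lborel)"
        using False by (auto intro!: nn_integral_cong simp: B_def inv indicator_def
            output_symmetric_flip[OF sym, of "w $ \<tau> i" "w $ i"])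
      finally show ?thesis .
    qed
  qed
  also have "\<dots> = emeasure (channel_law q w) {y. \<forall>i. y $ i \<in> A i}"
    by (rule emeasure_channel_law_box[symmetric]) (use q in auto)
  finally show "emeasure (distr (channel_law q w) borel (signed_permutation w \<tau>)) {y. \<forall>i. y $ i \<in> A i} =
    emeasure (channel_law q w) {y. \<forall>i. y $ i \<in> A i}" .
qed auto

section \<open>Almost sure distinctness of reliabilities\<close>

text \<open>Distinct coordinates are independent under the channel law. Once coordinate
  \<open>i\<close> is fixed, equality asks coordinate \<open>j\<close> to lie in one level set of
  \<open>f\<close>, a null set; Fubini concludes. The intended \<open>f\<close> is the
  reliability.\<close>

lemma channel_law_coords_neq:
  fixes f :: "real \<Rightarrow> ereal"
  assumes q: "\<And>b. prob_density (q b)" and f[measurable]: "f \<in> borel_measurable borel"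
    and atomless: "\<And>x. emeasure (channel_law q w) {y. f (y $ j) = x} = 0" and "i \<noteq> j"
  shows "AE y in channel_law q w. f (y $ i) \<noteq> f (y $ j)"
proof -
  let ?P = "channel_law q w" and ?\<mu> = "\<lambda>k. distr (channel_law q w) borel (\<lambda>y. y $ k)"
  interpret P: prob_space ?P by (rule prob_space_channel_law[OF q])
  interpret \<mu>: prob_space "?\<mu> k" for k by (rule P.prob_space_distr) simp
  \<comment> \<open>A cylinder is a box whose other sides are \<open>UNIV\<close>, and these
    contribute factors 1.\<close>
  have marginal: "emeasure (?\<mu> k) A = (\<integral>\<^sup>+x. ennreal (q (w $ k) x) * indicator A x \<partial>lborel)"
    if [measurable]: "A \<in> sets borel" for k A
  proof -
    have "emeasure (?\<mu> k) A = emeasure ?P {y. \<forall>l. y $ l \<in> (if l = k then A else UNIV)}"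
      by (subst emeasure_distr) (auto intro!: arg_cong2[where f = emeasure])
    also have "\<dots> = (\<Prod>l\<in>UNIV. \<integral>\<^sup>+x. ennreal (q (w $ l) x) * indicator (if l = k then A else UNIV) x \<partial>lborel)"
      using that q by (intro emeasure_channel_law_box) auto
    also have "\<dots> = (\<Prod>l\<in>UNIV. if l = k then (\<integral>\<^sup>+x. ennreal (q (w $ k) x) * indicator A x \<partial>lborel) else 1)"
      using q by (intro prod.cong) (auto simp: prob_density_def)
    finally show ?thesis by simp
  qed
  have "{p \<in> space (borel \<Otimes>\<^sub>M borel). f (fst p) = f (snd p)} \<in> sets (borel \<Otimes>\<^sub>M borel)"
    by measurable
  then have S: "{p. f (fst p) = f (snd p)} \<in> sets (borel \<Otimes>\<^sub>M borel)"
    by (simp add: space_pair_measure)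
  \<comment> \<open>Independence of the two coordinates, checked on rectangles seen as boxes with
    only two proper sides.\<close>
  have "?\<mu> i \<Otimes>\<^sub>M ?\<mu> j = distr ?P (borel \<Otimes>\<^sub>M borel) (\<lambda>y. (y $ i, y $ j))"
  proof (rule pair_measure_eqI)
    fix A B assume "A \<in> sets (?\<mu> i)" "B \<in> sets (?\<mu> j)"
    then have [measurable]: "A \<in> sets borel" "B \<in> sets borel" by auto
    let ?A = "\<lambda>l. if l = i then A else if l = j then B else UNIV"
    have "emeasure (distr ?P (borel \<Otimes>\<^sub>M borel) (\<lambda>y. (y $ i, y $ j))) (A \<times> B) =
      emeasure ?P {y. \<forall>l. y $ l \<in> ?A l}"
      using \<open>i \<noteq> j\<close> by (subst emeasure_distr) (auto intro!: arg_cong2[where f = emeasure])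
    also have "\<dots> = (\<Prod>l\<in>UNIV. \<integral>\<^sup>+x. ennreal (q (w $ l) x) * indicator (?A l) x \<partial>lborel)"
      using q by (intro emeasure_channel_law_box) auto
    \<comment> \<open>Since \<open>i \<noteq> j\<close>, at most one of the two conditionals differs
      from 1 at each \<open>l\<close>; in this form the product splits in two.\<close>
    also have "\<dots> = (\<Prod>l\<in>UNIV. (if l = i then emeasure (?\<mu> i) A else 1) * (if l = j then emeasure (?\<mu> j) B else 1))"
      using q \<open>i \<noteq> j\<close> by (intro prod.cong) (auto simp: prob_density_def marginal)
    also have "\<dots> = emeasure (?\<mu> i) A * emeasure (?\<mu> j) B"
      by (subst prod.distrib) simp
    finally show "emeasure (?\<mu> i) A * emeasure (?\<mu> j) B =
      emeasure (distr ?P (borel \<Otimes>\<^sub>M borel) (\<lambda>y. (y $ i, y $ j))) (A \<times> B)" by simp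
  next
    show "sigma_finite_measure (?\<mu> i)" "sigma_finite_measure (?\<mu> j)"
      by (rule \<mu>.sigma_finite_measure_axioms)+
    show "sets (?\<mu> i \<Otimes>\<^sub>M ?\<mu> j) = sets (distr ?P (borel \<Otimes>\<^sub>M borel) (\<lambda>y. (y $ i, y $ j)))"
      using sets_pair_measure_cong[of "?\<mu> i" borel "?\<mu> j" borel] by simp
  qed
  moreover have "emeasure (?\<mu> i \<Otimes>\<^sub>M ?\<mu> j) {p. f (fst p) = f (snd p)} = 0"
  proof -
    have "emeasure (?\<mu> i \<Otimes>\<^sub>M ?\<mu> j) {p. f (fst p) = f (snd p)} =
      (\<integral>\<^sup>+x. emeasure (?\<mu> j) (Pair x -` {p. f (fst p) = f (snd p)}) \<partial>?\<mu> i)"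
      using S sets_pair_measure_cong[of "?\<mu> i" borel "?\<mu> j" borel]
      by (intro \<mu>.emeasure_pair_measure_alt) simp
    also have "\<dots> = (\<integral>\<^sup>+x. 0 \<partial>?\<mu> i)"
    proof (intro nn_integral_cong)
      fix x
      have "emeasure (?\<mu> j) {b. f b = f x} = emeasure ?P {y. f (y $ j) = f x}"
        by (subst emeasure_distr) (auto intro!: arg_cong2[where f = emeasure])
      moreover have "Pair x -` {p. f (fst p) = f (snd p)} = {b. f b = f x}" by auto
      ultimately show "emeasure (?\<mu> j) (Pair x -` {p. f (fst p) = f (snd p)}) = 0"
        using atomless by simp
    qed
    finally show ?thesis by simp
  qed
  ultimately have "emeasure (distr ?P (borel \<Otimes>\<^sub>M borel) (\<lambda>y. (y $ i, y $ j))) {p. f (fst p) = f (snd p)} = 0"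
    by simp
  then have "emeasure ?P {y. f (y $ i) = f (y $ j)} = 0"
    by (subst (asm) emeasure_distr) (simp_all add: S)
  then show ?thesis
    by (intro AE_I[where N = "{y. f (y $ i) = f (y $ j)}"]) auto
qed

section \<open>Rank permutations and hits under signed permutations\<close>

text \<open>An element of a finite linear order is determined by the number of elements below it.
  For a value \<open>h i\<close> of a bijection this number counts the \<open>j\<close> with
  \<open>h j < h i\<close>, so it depends only on the induced order.\<close>

lemma order_isomorphic_bij_eq:
  fixes f g :: "'n::finite \<Rightarrow> 'm::{finite,linorder}"
  assumes "bij f" "bij g" "\<And>i j. f i < f j \<longleftrightarrow> g i < g j"
  shows "f = g"
proof
  fix i
  have card: "card {..<h i} = card {j. h j < h i}" if "bij h" for h :: "'n \<Rightarrow> 'm"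
  proof -
    have "{..<h i} = h ` {j. h j < h i}"
      using \<open>bij h\<close> by (auto simp: image_iff) (metis bij_pointE)
    then show ?thesis
      using \<open>bij h\<close> by (metis card_image bij_is_inj inj_on_subset subset_UNIV)
  qed
  have "card {..<f i} = card {..<g i}" using assms by (simp add: card)
  moreover have "x < y \<Longrightarrow> card {..<x} < card {..<y}" for x y :: 'm
    by (rule psubset_card_mono) auto
  ultimately show "f i = g i" by (metis less_irrefl linorder_neqE)
qed

text \<open>Sign changes leave reliabilities alone, so the new reliability at \<open>i\<close> is
  the old one at \<open>\<tau> i\<close>. Both sides are then bijections that induce the same order
  on coordinates.\<close>

lemma rank_signed_permutation:
  fixes r :: "real ^ 'n::{finite,linorder} \<Rightarrow> 'n \<Rightarrow> 'n"
  assumes q: "\<And>b. prob_density (q b)" and sym: "output_symmetric q"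
    and r: "permutation_law r" "rank_based q r" and \<tau>: "bij \<tau>"
    and neq: "\<And>i j. i \<noteq> j \<Longrightarrow> \<bar>llr q (y $ i)\<bar> \<noteq> \<bar>llr q (y $ j)\<bar>"
  shows "r (signed_permutation w \<tau> y) = r y \<circ> \<tau>"
proof (rule order_isomorphic_bij_eq)
  show "bij (r (signed_permutation w \<tau> y))" "bij (r y \<circ> \<tau>)"
    using r \<tau> by (auto simp: permutation_law_def bij_comp)
  \<comment> \<open>\<open>rank_based\<close> provides one direction; without ties, trichotomy gives
    the converse.\<close>
  have rank: "r z i < r z j \<longleftrightarrow> \<bar>llr q (z $ i)\<bar> < \<bar>llr q (z $ j)\<bar>"
    if "\<And>i j. i \<noteq> j \<Longrightarrow> \<bar>llr q (z $ i)\<bar> \<noteq> \<bar>llr q (z $ j)\<bar>" for z i j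
    using r(2) that unfolding rank_based_def by (metis less_asym linorder_neqE)
  have eq: "\<bar>llr q (signed_permutation w \<tau> y $ i)\<bar> = \<bar>llr q (y $ \<tau> i)\<bar>" for i
    by (simp add: signed_permutation_def llr_minus[OF sym q])
  have "\<tau> i \<noteq> \<tau> j" if "i \<noteq> j" for i j
    using \<tau> that by (metis bij_is_inj injD)
  then show "r (signed_permutation w \<tau> y) i < r (signed_permutation w \<tau> y) j \<longleftrightarrow>
      (r y \<circ> \<tau>) i < (r y \<circ> \<tau>) j" for i j
    using neq by (subst rank) (auto simp: eq rank)
qed

text \<open>In characteristic two the hard decision moves to the other side unchanged: a hit means
  that the permuted pattern is the actual error word.\<close>

lemma candidate_eq_iff:
  "candidate q r e t y = w \<longleftrightarrow> permute_coords (r y) (e t) = hard_decision q y + w"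
proof -
  have "a + b = c \<longleftrightarrow> b = a + c" for a b c :: bit
    by (cases a; cases b; cases c) simp_all
  then show ?thesis unfolding candidate_def vec_eq_iff by simp
qed

text \<open>Error word and permuted pattern are both reindexed by \<open>\<tau>\<close>, so the
  equation between them is the same one with its coordinates listed in another order.\<close>

lemma candidate_signed_permutation:
  fixes r :: "real ^ 'n::{finite,linorder} \<Rightarrow> 'n \<Rightarrow> 'n"
  assumes q: "\<And>b. prob_density (q b)" and sym: "output_symmetric q"
    and \<tau>: "bij \<tau>" and eq: "r (signed_permutation w \<tau> y) = r y \<circ> \<tau>"
    and nz: "\<And>i. llr q (y $ i) \<noteq> 0"
  shows "candidate q r e t (signed_permutation w \<tau> y) = w \<longleftrightarrow> candidate q r e t y = w"
proof -
  \<comment> \<open>Where the sent bits differ, the sign flip also flips the hard decision. This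
    requires a nonzero \<open>llr\<close>, because at zero the hard decision is 0 for either
    sign.\<close>
  have *: "(hard_decision q (signed_permutation w \<tau> y) + w) $ i = (hard_decision q y + w) $ \<tau> i" for i
    using nz[of "\<tau> i"]
    by (cases "w $ i"; cases "w $ \<tau> i")
      (auto simp: hard_decision_def signed_permutation_def llr_minus[OF sym q] order_less_le)
  have "candidate q r e t (signed_permutation w \<tau> y) = w \<longleftrightarrow>
      (\<forall>i. e t $ r y (\<tau> i) = (hard_decision q y + w) $ \<tau> i)"
    unfolding candidate_eq_iff unfolding vec_eq_iff * by (simp add: permute_coords_def eq)
  also have "\<dots> \<longleftrightarrow> (\<forall>i. e t $ r y i = (hard_decision q y + w) $ i)"
    using \<tau> by (metis bij_pointE)
  also have "\<dots> \<longleftrightarrow> candidate q r e t y = w"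
    unfolding candidate_eq_iff unfolding vec_eq_iff by (simp add: permute_coords_def)
  finally show ?thesis .
qed

text \<open>Signed permutations preserve the law and the event \<open>S\<close>, and they act on
  ranks by composition with \<open>\<tau>\<close>. Hence all rank permutations have equal mass
  within \<open>S\<close>, and the mass of \<open>F\<close> is obtained by counting.\<close>

lemma measure_rank_indep:
  fixes r :: "real ^ 'n::{finite,linorder} \<Rightarrow> 'n \<Rightarrow> 'n"
  assumes q: "\<And>b. prob_density (q b)" and sym: "output_symmetric q"
    and r: "permutation_law r" "rank_based q r"
    and neq: "AE y in channel_law q w. \<forall>i j. i \<noteq> j \<longrightarrow> \<bar>llr q (y $ i)\<bar> \<noteq> \<bar>llr q (y $ j)\<bar>"
    and S[measurable]: "Measurable.pred borel S"
    and inv: "\<And>\<tau>. bij \<tau> \<Longrightarrow> AE y in channel_law q w. S (signed_permutation w \<tau> y) \<longleftrightarrow> S y"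
  shows "measure (channel_law q w) {y. r y \<in> F \<and> S y} =
    card (F \<inter> {\<sigma>. bij \<sigma>}) / card {\<sigma> :: 'n \<Rightarrow> 'n. bij \<sigma>} * measure (channel_law q w) {y. S y}"
proof -
  let ?P = "channel_law q w" and ?B = "{\<sigma> :: 'n \<Rightarrow> 'n. bij \<sigma>}"
  interpret P: prob_space ?P by (rule prob_space_channel_law[OF q])
  have [measurable]: "r \<in> borel \<rightarrow>\<^sub>M count_space UNIV" using r by (simp add: permutation_law_def)
  note [measurable] = signed_permutation_measurable
  define p where "p \<sigma> = measure ?P {y. r y = \<sigma> \<and> S y}" for \<sigma>
  have shift: "p (\<sigma> \<circ> \<tau>) = p \<sigma>" if \<tau>: "bij \<tau>" for \<sigma> \<tau>
  proof -
    have "p (\<sigma> \<circ> \<tau>) = measure (distr ?P borel (signed_permutation w \<tau>)) {y. r y = \<sigma> \<circ> \<tau> \<and> S y}"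
      by (simp add: p_def distr_signed_permutation[OF q sym \<tau>])
    also have "\<dots> = measure ?P {y \<in> space ?P. r (signed_permutation w \<tau> y) = \<sigma> \<circ> \<tau> \<and> S (signed_permutation w \<tau> y)}"
      by (subst measure_distr) (auto intro!: arg_cong2[where f = measure])
    also have "\<dots> = measure ?P {y \<in> space ?P. r y = \<sigma> \<and> S y}"
    proof (rule P.prob_eq_AE)
      have cancel: "f \<circ> \<tau> = \<sigma> \<circ> \<tau> \<longleftrightarrow> f = \<sigma>" for f
        using \<tau> by (metis bij_is_surj comp_assoc comp_id surj_iff)
      show "AE y in ?P. (r (signed_permutation w \<tau> y) = \<sigma> \<circ> \<tau> \<and> S (signed_permutation w \<tau> y)) \<longleftrightarrow>
          (r y = \<sigma> \<and> S y)"
        using neq inv[OF \<tau>]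
      proof eventually_elim
        case (elim y)
        then have "r (signed_permutation w \<tau> y) = r y \<circ> \<tau>"
          by (intro rank_signed_permutation[OF q sym r \<tau>]) auto
        then show ?case using elim by (simp add: cancel)
      qed
    qed measurable
    finally show ?thesis by (simp add: p_def)
  qed
  \<comment> \<open>Writing \<open>\<sigma>\<close> as \<open>id \<circ> \<sigma>\<close>, one shift
    reaches every bijection from the identity.\<close>
  have const: "p \<sigma> = p id" if "bij \<sigma>" for \<sigma>
    using shift[of \<sigma> id] that by simp
  have sum: "measure ?P {y. r y \<in> G \<and> S y} = card (G \<inter> ?B) * p id" for G
  proof -
    have "{y. r y \<in> G \<and> S y} = (\<Union>\<sigma>\<in>G \<inter> ?B. {y. r y = \<sigma> \<and> S y})"
      using r(1) by (auto simp: permutation_law_def)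
    also have "measure ?P \<dots> = (\<Sum>\<sigma>\<in>G \<inter> ?B. p \<sigma>)"
      unfolding p_def
      by (rule P.finite_measure_finite_Union) (auto simp: disjoint_family_on_def)
    also have "\<dots> = (\<Sum>\<sigma>\<in>G \<inter> ?B. p id)" by (rule sum.cong) (auto intro: const)
    finally show ?thesis by simp
  qed
  have "card ?B \<noteq> 0" using bij_id by (auto simp: card_eq_0_iff)
  \<comment> \<open>The choice \<open>G = UNIV\<close> fixes the common mass
    \<open>p id\<close>.\<close>
  moreover have "measure ?P {y. S y} = card ?B * p id" using sum[of UNIV] by simp
  ultimately show ?thesis unfolding sum by simp
qed

section \<open>Candidates in characteristic two\<close>

lemma permute_coords_add: "permute_coords \<sigma> (a + b) = permute_coords \<sigma> a + permute_coords \<sigma> b"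
  by (simp add: permute_coords_def vec_eq_iff)

lemma bit_vec_add_self: "(v :: bit ^ 'n) + v = 0"
  by (simp add: vec_eq_iff)

text \<open>All candidates share one hard decision, which cancels in their sum. This is where the
  permuted pattern differences of the error formula come from.\<close>

lemma candidate_shift:
  fixes r :: "real ^ 'n::finite \<Rightarrow> 'n \<Rightarrow> 'n"
  shows "candidate q r e t' y = candidate q r e t y + permute_coords (r y) (e t' + e t)"
proof -
  have "a + c = a + b + (c + b)" for a b c :: "bit ^ 'n"
  proof -
    have "a + b + (c + b) = a + c + (b + b)" by (simp only: ac_simps)
    then show ?thesis by (simp only: bit_vec_add_self add_0_right)
  qed
  then show ?thesis unfolding candidate_def permute_coords_add .
qed

section \<open>Transmission of a uniform codeword\<close>

text \<open>Gathers the assumptions on code and channel common to both formulas; symmetry, atomless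
  reliabilities and the rank rule are added for the second one.\<close>

locale coded_channel = prob_space M for M :: "'a measure" +
  fixes q :: "bit \<Rightarrow> real \<Rightarrow> real"
    and C :: "(bit ^ 'n::{finite,linorder}) set"
    and W :: "'a \<Rightarrow> bit ^ 'n::{finite,linorder}"
    and Y :: "'a \<Rightarrow> real ^ 'n::{finite,linorder}"
  assumes density: "\<And>b. prob_density (q b)"
    and subspace: "vec.subspace C"
    and W_measurable[measurable]: "W \<in> M \<rightarrow>\<^sub>M count_space UNIV"
    and Y_measurable[measurable]: "Y \<in> M \<rightarrow>\<^sub>M borel"
    and W_uniform: "distr M (count_space UNIV) W = measure_pmf (pmf_of_set C)"
    and channel: "channel_output M q C W Y"
begin

lemma zero_in_code: "0 \<in> C"
  using subspace by (rule vec.subspace_0)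

lemma prob_W_eq: "w \<in> C \<Longrightarrow> prob {\<omega> \<in> space M. W \<omega> = w} = 1 / card C"
proof -
  assume "w \<in> C"
  have "prob {\<omega> \<in> space M. W \<omega> = w} = measure (distr M (count_space UNIV) W) {w}"
    by (subst measure_distr) (auto intro!: arg_cong2[where f = measure])
  also have "\<dots> = 1 / card C"
    using \<open>w \<in> C\<close> unfolding W_uniform by (subst measure_pmf_of_set) auto
  finally show ?thesis .
qed

lemma AE_W_in_code: "AE \<omega> in M. W \<omega> \<in> C"
proof -
  have "AE w in distr M (count_space UNIV) W. w \<in> C"
    unfolding W_uniform using zero_in_code by (subst AE_measure_pmf_iff, subst set_pmf_of_set) auto
  then show ?thesis by (subst (asm) AE_distr_iff) auto
qed

text \<open>Unfolds the conditioning in \<open>channel_output\<close>: the joint probability is the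
  channel law weighted by the chance \<open>1 / card C\<close> of sending \<open>w\<close>, which is
  positive because \<open>0 \<in> C\<close>.\<close>

lemma prob_W_Y:
  assumes "w \<in> C" and A[measurable]: "A \<in> sets borel"
  shows "prob {\<omega> \<in> space M. W \<omega> = w \<and> Y \<omega> \<in> A} = measure (channel_law q w) A / card C"
proof -
  let ?E = "{\<omega> \<in> space M. W \<omega> = w}"
  have card: "real (card C) > 0" using zero_in_code by (auto simp: card_gt_0_iff)
  then have "prob ?E > 0"
    unfolding prob_W_eq[OF \<open>w \<in> C\<close>] by (rule divide_pos_pos[OF zero_less_one])
  then have nz: "emeasure M ?E \<noteq> 0"
    by (simp add: emeasure_eq_measure)
  have "distr (uniform_measure M ?E) lborel Y = channel_law q w"
    using channel \<open>w \<in> C\<close> by (simp add: channel_output_def distributed_def)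
  then have "measure (channel_law q w) A = measure (distr (uniform_measure M ?E) lborel Y) A" by simp
  also have "\<dots> = measure (uniform_measure M ?E) (Y -` A \<inter> space M)"
    by (subst measure_distr) auto
  also have "\<dots> = prob (?E \<inter> (Y -` A \<inter> space M)) / prob ?E"
    using nz by (intro measure_uniform_measure) (auto simp: emeasure_eq_measure)
  also have "?E \<inter> (Y -` A \<inter> space M) = {\<omega> \<in> space M. W \<omega> = w \<and> Y \<omega> \<in> A}" by auto
  finally have eq: "measure (channel_law q w) A =
      prob {\<omega> \<in> space M. W \<omega> = w \<and> Y \<omega> \<in> A} / (1 / card C)"
    unfolding prob_W_eq[OF \<open>w \<in> C\<close>] .
  have "x = x / (1 / c) / c" if "c > 0" for x c :: real
    using that by simp
  from this[OF card] show ?thesis unfolding eq .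
qed

text \<open>Total probability over the sent codeword. The set may depend on \<open>w\<close> because
  a hit compares the output with the sent word.\<close>

lemma prob_total:
  assumes A[measurable]: "\<And>w. A w \<in> sets borel"
  shows "prob {\<omega> \<in> space M. Y \<omega> \<in> A (W \<omega>)} = (\<Sum>w\<in>C. measure (channel_law q w) (A w)) / card C"
proof -
  have eq: "{\<omega> \<in> space M. Y \<omega> \<in> A (W \<omega>)} = (\<Union>w\<in>UNIV. {\<omega> \<in> space M. W \<omega> = w \<and> Y \<omega> \<in> A w})"
    by auto
  have "prob {\<omega> \<in> space M. Y \<omega> \<in> A (W \<omega>)} = prob (\<Union>w\<in>C. {\<omega> \<in> space M. W \<omega> = w \<and> Y \<omega> \<in> A w})"
  proof (rule finite_measure_eq_AE)
    show "AE \<omega> in M. \<omega> \<in> {\<omega> \<in> space M. Y \<omega> \<in> A (W \<omega>)} \<longleftrightarrow>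
        \<omega> \<in> (\<Union>w\<in>C. {\<omega> \<in> space M. W \<omega> = w \<and> Y \<omega> \<in> A w})"
      using AE_W_in_code by eventually_elim auto
    show "{\<omega> \<in> space M. Y \<omega> \<in> A (W \<omega>)} \<in> events"
      unfolding eq by (rule sets.finite_UN) simp_all
    show "(\<Union>w\<in>C. {\<omega> \<in> space M. W \<omega> = w \<and> Y \<omega> \<in> A w}) \<in> events"
      by (rule sets.finite_UN) simp_all
  qed
  also have "\<dots> = (\<Sum>w\<in>C. prob {\<omega> \<in> space M. W \<omega> = w \<and> Y \<omega> \<in> A w})"
    by (rule finite_measure_finite_Union) (auto simp: disjoint_family_on_def)
  also have "\<dots> = (\<Sum>w\<in>C. measure (channel_law q w) (A w)) / card C"
    by (simp add: prob_W_Y sum_divide_distrib)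
  finally show ?thesis .
qed

section \<open>Hitting and success probabilities\<close>

text \<open>The posterior is evaluated at a random word, so it is split according to the value
  \<open>w\<close> of the candidate. The event that the candidate is \<open>w\<close> depends on
  \<open>Y\<close> alone, and the averaging property of conditional expectation turns each piece
  into a joint probability.\<close>

lemma hit_prob_eq:
  assumes r: "permutation_law r"
  shows "hit_prob M q W Y r e t = \<P>(\<omega> in M. candidate q r e t (Y \<omega>) = W \<omega>)"
proof -
  let ?F = "vimage_algebra (space M) Y borel"
  let ?c = "\<lambda>\<omega>. candidate q r e t (Y \<omega>)"
  note [measurable] = candidate_measurable[OF density r]
  have sub: "subalgebra M ?F"
    using measurable_sets[OF Y_measurable] by (auto simp: subalgebra_def sets_vimage_algebra2)
  interpret F: finite_measure_subalgebra M ?F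
    by unfold_locales (rule sub)
  have YF: "Y \<in> ?F \<rightarrow>\<^sub>M borel"
    by (rule measurable_vimage_algebra1) simp
  have c: "?c \<in> ?F \<rightarrow>\<^sub>M count_space UNIV"
    using YF by measurable
  have int: "integrable M (\<lambda>\<omega>. indicator {\<omega>. ?c \<omega> = w} \<omega> * posterior M W Y w \<omega>)" (is "?I w")
   and eq: "(\<integral>\<omega>. indicator {\<omega>. ?c \<omega> = w} \<omega> * posterior M W Y w \<omega> \<partial>M) =
      \<P>(\<omega> in M. ?c \<omega> = w \<and> W \<omega> = w)" (is "?E w") for w
  proof -
    \<comment> \<open>Measurability with respect to \<open>?F\<close>, not merely \<open>M\<close>,
      is what lets the indicator pass through the conditional expectation.\<close>
    have 1: "(indicator {\<omega>. ?c \<omega> = w} :: 'a \<Rightarrow> real) \<in> borel_measurable ?F"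
      using c by measurable
    have ind: "indicator {\<omega>. ?c \<omega> = w} \<omega> * indicator {\<omega> \<in> space M. W \<omega> = w} \<omega> =
      (indicator {\<omega> \<in> space M. ?c \<omega> = w \<and> W \<omega> = w} \<omega> :: real)" for \<omega>
      by (auto simp: indicator_def)
    have 2: "integrable M (\<lambda>\<omega>. indicator {\<omega>. ?c \<omega> = w} \<omega> * indicator {\<omega> \<in> space M. W \<omega> = w} \<omega> :: real)"
      unfolding ind by (simp add: integrable_indicator_iff emeasure_eq_measure)
    note * = F.real_cond_exp_intg[OF 2 1]
    show "?I w" unfolding posterior_def by (rule *(1)) simp
    show "?E w" unfolding posterior_def by (subst *(2)) (simp_all add: ind)
  qed
  have posterior: "posterior M W Y (?c \<omega>) \<omega> = (\<Sum>w\<in>UNIV. indicator {\<omega>. ?c \<omega> = w} \<omega> * posterior M W Y w \<omega>)" for \<omega>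
    by (simp add: indicator_def if_distrib[of "\<lambda>x. x * _"] cong: if_cong)
  have "hit_prob M q W Y r e t = (\<Sum>w\<in>UNIV. \<P>(\<omega> in M. ?c \<omega> = w \<and> W \<omega> = w))"
    by (simp only: hit_prob_def posterior Bochner_Integration.integral_sum[OF int] eq)
  also have "\<dots> = prob (\<Union>w\<in>UNIV. {\<omega> \<in> space M. ?c \<omega> = w \<and> W \<omega> = w})"
    by (rule finite_measure_finite_Union[symmetric]) (auto simp: disjoint_family_on_def)
  also have "(\<Union>w\<in>UNIV. {\<omega> \<in> space M. ?c \<omega> = w \<and> W \<omega> = w}) = {\<omega> \<in> space M. ?c \<omega> = W \<omega>}"
    by auto
  finally show ?thesis .
qed

text \<open>Once candidate \<open>t\<close> equals the codeword \<open>w\<close>, an earlier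
  candidate is \<open>w\<close> plus a permuted difference, and adding \<open>w\<close> does not
  change membership in the subspace. So the failed earlier tests become conditions on
  differences.\<close>

lemma orb_grand_eq_Some_iff:
  assumes w: "w \<in> C"
  shows "orb_grand q C r e T y = Some w \<longleftrightarrow>
    (\<exists>t\<in>{1..T}. (\<forall>t'\<in>{1..<t}. permute_coords (r y) (e t' + e t) \<notin> C) \<and> candidate q r e t y = w)"
proof -
  have mem: "candidate q r e t' y \<in> C \<longleftrightarrow> permute_coords (r y) (e t' + e t) \<in> C"
    if "candidate q r e t y = w" for t t'
  proof -
    have "w + (w + v) = v" for v using bit_vec_add_self[of w] by (simp flip: add.assoc)
    then have "w + v \<in> C \<longleftrightarrow> v \<in> C" for v
      using w vec.subspace_add[OF subspace] by metis
    then show ?thesis using that candidate_shift[of q r e t' y t] by simp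
  qed
  let ?Q = "\<lambda>t. t \<in> {1..T} \<and> candidate q r e t y \<in> C"
  show ?thesis
  proof
    assume *: "orb_grand q C r e T y = Some w"
    then have ex: "\<exists>t. ?Q t" and hit: "candidate q r e (LEAST t. ?Q t) y = w"
      by (auto simp: orb_grand_def split: if_splits)
    have "?Q (LEAST t. ?Q t)" using ex by (rule LeastI_ex)
    moreover have "candidate q r e t' y \<notin> C" if "t' \<in> {1..<LEAST t. ?Q t}" for t'
      using that not_less_Least[of t' ?Q] calculation by auto
    ultimately show "\<exists>t\<in>{1..T}. (\<forall>t'\<in>{1..<t}. permute_coords (r y) (e t' + e t) \<notin> C) \<and> candidate q r e t y = w"
      using hit mem[OF hit] by blast
  next
    assume "\<exists>t\<in>{1..T}. (\<forall>t'\<in>{1..<t}. permute_coords (r y) (e t' + e t) \<notin> C) \<and> candidate q r e t y = w"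
    then obtain t where t: "t \<in> {1..T}" "candidate q r e t y = w"
      and first: "\<And>t'. t' \<in> {1..<t} \<Longrightarrow> candidate q r e t' y \<notin> C"
      using mem by blast
    \<comment> \<open>Step \<open>t\<close> passes its own test because \<open>w \<in> C\<close>,
      and no earlier step does.\<close>
    have "(LEAST t. ?Q t) = t"
      using t w first by (intro Least_equality) (auto simp: not_less[symmetric])
    then show "orb_grand q C r e T y = Some w"
      using t w by (auto simp: orb_grand_def)
  qed
qed

text \<open>The success events of different steps are disjoint: if two steps hit the same word,
  their permuted difference is 0, which lies in \<open>C\<close> and violates the condition of the
  later step.\<close>

lemma succ_prob_eq:
  assumes r: "permutation_law r"
  shows "succ_prob M W Y (orb_grand q C r e T) =
    (\<Sum>t=1..T. \<P>(\<omega> in M. (\<forall>t'\<in>{1..<t}. permute_coords (r (Y \<omega>)) (e t' + e t) \<notin> C) \<and>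
      candidate q r e t (Y \<omega>) = W \<omega>))"
proof -
  note [measurable] = candidate_measurable[OF density r] orb_grand_measurable[OF density r]
  have [measurable]: "r \<in> borel \<rightarrow>\<^sub>M count_space UNIV" using r by (simp add: permutation_law_def)
  define A where "A t = {\<omega> \<in> space M. (\<forall>t'\<in>{1..<t}. permute_coords (r (Y \<omega>)) (e t' + e t) \<notin> C) \<and>
      candidate q r e t (Y \<omega>) = W \<omega>}" for t
  have A: "A t \<in> events" for t unfolding A_def by measurable
  have "A t \<inter> A t' = {}" if "t \<in> {1..T}" "t < t'" for t t'
  proof -
    have "\<omega> \<notin> A t'" if "\<omega> \<in> A t" for \<omega>
    proof
      assume "\<omega> \<in> A t'"
      then have "candidate q r e t (Y \<omega>) = candidate q r e t' (Y \<omega>)"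
        using \<open>\<omega> \<in> A t\<close> by (simp add: A_def)
      then have "permute_coords (r (Y \<omega>)) (e t + e t') = 0"
        using candidate_shift[of q r e t "Y \<omega>" t'] by simp
      moreover have "permute_coords (r (Y \<omega>)) (e t + e t') \<notin> C"
        using \<open>\<omega> \<in> A t'\<close> \<open>t \<in> {1..T}\<close> \<open>t < t'\<close> by (simp add: A_def)
      ultimately show False using zero_in_code by simp
    qed
    then show ?thesis by auto
  qed
  then have disj: "disjoint_family_on A {1..T}"
    unfolding disjoint_family_on_def by (metis Int_commute linorder_neqE_nat)
  have "succ_prob M W Y (orb_grand q C r e T) = prob (\<Union>t\<in>{1..T}. A t)"
    unfolding succ_prob_def
  proof (rule finite_measure_eq_AE)
    \<comment> \<open>The description of the decoder output needs a sent word in \<open>C\<close>,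
      which is available almost surely.\<close>
    show "AE \<omega> in M. \<omega> \<in> {\<omega> \<in> space M. orb_grand q C r e T (Y \<omega>) = Some (W \<omega>)} \<longleftrightarrow>
        \<omega> \<in> (\<Union>t\<in>{1..T}. A t)"
      using AE_W_in_code by eventually_elim (auto simp: A_def orb_grand_eq_Some_iff)
    show "{\<omega> \<in> space M. orb_grand q C r e T (Y \<omega>) = Some (W \<omega>)} \<in> events"
      by measurable
    show "(\<Union>t\<in>{1..T}. A t) \<in> events"
      using A by (intro sets.finite_UN) auto
  qed
  also have "\<dots> = (\<Sum>t=1..T. prob (A t))"
    using A disj by (intro finite_measure_finite_Union) auto
  finally show ?thesis unfolding A_def .
qed

lemma err_prob_eq:
  assumes r: "permutation_law r"
  shows "err_prob M W Y (orb_grand q C r e T) = 1 - succ_prob M W Y (orb_grand q C r e T)"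
proof -
  note [measurable] = orb_grand_measurable[OF density r]
  show ?thesis unfolding err_prob_def succ_prob_def by (rule prob_neg) measurable
qed

section \<open>Independence of the rank permutation and the hit\<close>

text \<open>Given each sent word, rank and hit are independent and the rank is uniform. The
  resulting factor \<open>?\<kappa>\<close> is the same for all words, so the factorization survives
  averaging over \<open>C\<close>; independence given each word alone would not ensure this.\<close>

lemma rank_pattern_indep_hit:
  assumes r: "permutation_law r" "rank_based q r" and sym: "output_symmetric q"
    and atomless: "atomless_reliabilities M q Y"
  shows "\<P>(\<omega> in M. r (Y \<omega>) \<in> F \<and> candidate q r e t (Y \<omega>) = W \<omega>) =
    \<P>(\<omega> in M. candidate q r e t (Y \<omega>) = W \<omega>) * \<P>(\<omega> in M. r (Y \<omega>) \<in> F)"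
proof -
  note [measurable] = candidate_measurable[OF density r(1)] llr_measurable[OF density]
  have [measurable]: "r \<in> borel \<rightarrow>\<^sub>M count_space UNIV" using r by (simp add: permutation_law_def)
  let ?\<kappa> = "card (F \<inter> {\<sigma>. bij \<sigma>}) / card {\<sigma> :: 'n \<Rightarrow> 'n. bij \<sigma>}"
  have "C \<noteq> {}" using zero_in_code by blast
  then have card: "card C > 0" by (simp add: card_gt_0_iff)
  have law: "measure (channel_law q w) {y. r y \<in> F \<and> candidate q r e t y = w} =
        ?\<kappa> * measure (channel_law q w) {y. candidate q r e t y = w}"
      "measure (channel_law q w) {y. r y \<in> F} = ?\<kappa>" if "w \<in> C" for w
  proof -
    interpret P: prob_space "channel_law q w" by (rule prob_space_channel_law[OF density])
    \<comment> \<open>The atomless hypothesis concerns the mixture over all sent words. It passes to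
      each channel law because every codeword has positive probability.\<close>
    have atom: "emeasure (channel_law q w) {y. \<bar>llr q (y $ i)\<bar> = x} = 0" for i x
    proof -
      have "prob {\<omega> \<in> space M. W \<omega> = w \<and> Y \<omega> \<in> {y. \<bar>llr q (y $ i)\<bar> = x}} \<le>
          prob {\<omega> \<in> space M. \<bar>llr q (Y \<omega> $ i)\<bar> = x}"
        by (rule finite_measure_mono) auto
      also have "\<dots> = 0" using atomless by (simp add: atomless_reliabilities_def)
      finally have "prob {\<omega> \<in> space M. W \<omega> = w \<and> Y \<omega> \<in> {y. \<bar>llr q (y $ i)\<bar> = x}} = 0"
        by (simp add: measure_le_0_iff)
      then have "measure (channel_law q w) {y. \<bar>llr q (y $ i)\<bar> = x} = 0"
        using card by (subst (asm) prob_W_Y[OF \<open>w \<in> C\<close>]) auto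
      then show ?thesis by (simp add: P.emeasure_eq_measure)
    qed
    have "AE y in channel_law q w. \<bar>llr q (y $ i)\<bar> \<noteq> \<bar>llr q (y $ j)\<bar>" if "i \<noteq> j" for i j
      using atom that by (intro channel_law_coords_neq[where f = "\<lambda>x. \<bar>llr q x\<bar>"] density) auto
    then have neq: "AE y in channel_law q w. \<forall>i j. i \<noteq> j \<longrightarrow> \<bar>llr q (y $ i)\<bar> \<noteq> \<bar>llr q (y $ j)\<bar>"
      by (simp add: AE_all_countable)
    have "AE y in channel_law q w. llr q (y $ i) \<noteq> 0" for i
      \<comment> \<open>A zero \<open>llr\<close> is the atom at reliability 0.\<close>
      using atom[of i 0] by (intro AE_I[where N = "{y. \<bar>llr q (y $ i)\<bar> = 0}"]) auto
    then have nz: "AE y in channel_law q w. \<forall>i. llr q (y $ i) \<noteq> 0"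
      by (simp add: AE_all_countable)
    note indep = measure_rank_indep[OF density sym r neq]
    show "measure (channel_law q w) {y. r y \<in> F} = ?\<kappa>"
      \<comment> \<open>The trivial event yields the marginal law of the rank permutation.\<close>
      using indep[of "\<lambda>_. True" F] P.prob_space by simp
    have "AE y in channel_law q w. candidate q r e t (signed_permutation w \<tau> y) = w \<longleftrightarrow>
        candidate q r e t y = w" if \<tau>: "bij \<tau>" for \<tau>
      using neq nz
    proof eventually_elim
      case (elim y)
      then show ?case
        by (intro candidate_signed_permutation[OF density sym \<tau>]
            rank_signed_permutation[OF density sym r \<tau>]) auto
    qed
    then show "measure (channel_law q w) {y. r y \<in> F \<and> candidate q r e t y = w} =
        ?\<kappa> * measure (channel_law q w) {y. candidate q r e t y = w}"
      by (intro indep) auto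
  qed
  have "prob {\<omega> \<in> space M. r (Y \<omega>) \<in> F \<and> candidate q r e t (Y \<omega>) = W \<omega>} =
    ?\<kappa> * prob {\<omega> \<in> space M. candidate q r e t (Y \<omega>) = W \<omega>}"
    using prob_total[of "\<lambda>w. {y. r y \<in> F \<and> candidate q r e t y = w}"]
      prob_total[of "\<lambda>w. {y. candidate q r e t y = w}"]
    by (simp add: law sum_distrib_left)
  moreover have "prob {\<omega> \<in> space M. r (Y \<omega>) \<in> F} = ?\<kappa>"
    using prob_total[of "\<lambda>_. {y. r y \<in> F}"] \<open>C \<noteq> {}\<close> by (simp add: law)
  ultimately show ?thesis by simp
qed

end

section \<open>The two error rate formulas\<close>

theorem theorem4:
  fixes M :: "'a measure"
    and q :: "bit \<Rightarrow> real \<Rightarrow> real"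
    and C :: "(bit ^ 'n::{finite,linorder}) set"
    and K T :: nat
    and e :: "nat \<Rightarrow> bit ^ 'n::{finite,linorder}"
    and r :: "real ^ 'n::{finite,linorder} \<Rightarrow> 'n \<Rightarrow> 'n"
    and W :: "'a \<Rightarrow> bit ^ 'n::{finite,linorder}"
    and Y :: "'a \<Rightarrow> real ^ 'n::{finite,linorder}"
  assumes "prob_space M"
    and "\<And>b. prob_density (q b)"
    and "vec.subspace C" and "vec.dim C = K"
    and "inj_on e {1..T}"
    and "permutation_law r"
    and "W \<in> M \<rightarrow>\<^sub>M count_space UNIV"
    and "Y \<in> M \<rightarrow>\<^sub>M borel"
    and "distr M (count_space UNIV) W = measure_pmf (pmf_of_set C)"
    and "\<And>i. distr M (count_space UNIV) (\<lambda>\<omega>. W \<omega> $ i) = measure_pmf (pmf_of_set UNIV)"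
    and "channel_output M q C W Y"
  shows
    "err_prob M W Y (orb_grand q C r e T) = 1 - succ_prob M W Y (orb_grand q C r e T) \<and>
     1 - succ_prob M W Y (orb_grand q C r e T) =
       1 - (\<Sum>t=1..T. hit_prob M q W Y r e t *
              \<P>(\<omega> in M. (\<forall>t'\<in>{1..<t}. permute_coords (r (Y \<omega>)) (e t' + e t) \<notin> C)
                 \<bar> candidate q r e t (Y \<omega>) = W \<omega>)) \<and>
     (output_symmetric q \<and> atomless_reliabilities M q Y \<and> rank_based q r \<longrightarrow>
       err_prob M W Y (orb_grand q C r e T) =
         1 - (\<Sum>t=1..T. hit_prob M q W Y r e t *
                \<P>(\<omega> in M. \<forall>t'\<in>{1..<t}. permute_coords (r (Y \<omega>)) (e t' + e t) \<notin> C)))"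
proof -
  note r = \<open>permutation_law r\<close>
  interpret coded_channel M q C W Y
    using assms by (simp add: coded_channel_def coded_channel_axioms_def)
  note [measurable] = candidate_measurable[OF density r]
  have [measurable]: "r \<in> borel \<rightarrow>\<^sub>M count_space UNIV" using r by (simp add: permutation_law_def)
  let ?F = "\<lambda>t y. \<forall>t'\<in>{1..<t}. permute_coords (r y) (e t' + e t) \<notin> C"
  let ?hit = "\<lambda>t \<omega>. candidate q r e t (Y \<omega>) = W \<omega>"
  have cond: "\<P>(\<omega> in M. ?F t (Y \<omega>) \<and> ?hit t \<omega>) =
      hit_prob M q W Y r e t * \<P>(\<omega> in M. ?F t (Y \<omega>) \<bar> ?hit t \<omega>)" for t
  proof -
    \<comment> \<open>This settles the case of hit probability 0: the joint probability vanishes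
      too, in agreement with the conditional probability, which is then a division by zero with
      value 0.\<close>
    have "\<P>(\<omega> in M. ?F t (Y \<omega>) \<and> ?hit t \<omega>) \<le> \<P>(\<omega> in M. ?hit t \<omega>)"
      by (rule finite_measure_mono) auto
    then show ?thesis
      by (auto simp: hit_prob_eq[OF r] cond_prob_def measure_le_0_iff)
  qed
  have indep: "\<P>(\<omega> in M. ?F t (Y \<omega>) \<and> ?hit t \<omega>) =
      hit_prob M q W Y r e t * \<P>(\<omega> in M. ?F t (Y \<omega>))"
    if "output_symmetric q" "atomless_reliabilities M q Y" "rank_based q r" for t
    \<comment> \<open>The condition on earlier patterns depends on the output only through
      \<open>r y\<close>, so it is membership of the rank permutation in a fixed set.\<close>
    using rank_pattern_indep_hit[OF r, of "{\<sigma>. \<forall>t'\<in>{1..<t}. permute_coords \<sigma> (e t' + e t) \<notin> C}" e t] that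
    by (simp add: hit_prob_eq[OF r])
  show ?thesis
  proof (intro conjI impI)
    show "err_prob M W Y (orb_grand q C r e T) = 1 - succ_prob M W Y (orb_grand q C r e T)"
      by (rule err_prob_eq[OF r])
  next
    show "1 - succ_prob M W Y (orb_grand q C r e T) =
      1 - (\<Sum>t=1..T. hit_prob M q W Y r e t * \<P>(\<omega> in M. ?F t (Y \<omega>) \<bar> ?hit t \<omega>))"
      by (simp only: succ_prob_eq[OF r] cond)
  next
    assume "output_symmetric q \<and> atomless_reliabilities M q Y \<and> rank_based q r"
    then show "err_prob M W Y (orb_grand q C r e T) =
      1 - (\<Sum>t=1..T. hit_prob M q W Y r e t * \<P>(\<omega> in M. ?F t (Y \<omega>)))"
      by (simp only: err_prob_eq[OF r] succ_prob_eq[OF r] indep)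
  qed
qed

end
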